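(* Let $A$ and $B$ be Abelian heaps, and let $e_A\in A$ and $e_B\in B$. Then there is an isomorphism of heaps $$A\boxplus B\cong \mathrm{H}\big(\mathrm{G}(A;e_A)\oplus \mathrm{G}(B;e_B)\oplus \mathbb{Z}\big).$$
   Context: A heap is a set $H$ with a ternary operation $[-,-,-]$ such that $[[a,b,c],d,e]=[a,b,[c,d,e]]$ and $[a,b,b]=a=[b,b,a]$ for all $a,b,c,d,e\in H$. It is Abelian if $[a,b,c]=[c,b,a]$ for all $a,b,c$. Heap morphisms are maps preserving the ternary operation. For $e\in H$, the retract $\mathrm{G}(H;e)$ is the group on the set $H$ with product $a\cdot_e b=[a,e,b]$ and neutral element $e$ (Abelian if $H$ is Abelian). For a group $G$, $\mathrm{H}(G)$ is the heap on the set $G$ with $[g,h,k]=gh^{-1}k$. $A\boxplus B$ denotes the direct sum, i.e. the coproduct, of $A$ and $B$ in the category of Abelian heaps. $\oplus$ is the direct sum of Abelian groups. *)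

theory Defs
  imports "HOL-Algebra.Algebra"
begin

section \<open>Heaps\<close>

record 'a heap = "'a partial_object" +
  bracket :: "'a \<Rightarrow> 'a \<Rightarrow> 'a \<Rightarrow> 'a"

text \<open>The empty heap is allowed.\<close>

locale heap =
  fixes H :: "('a, 'm) heap_scheme" (structure)
  assumes closed [simp, intro]:
      "\<lbrakk>a \<in> carrier H; b \<in> carrier H; c \<in> carrier H\<rbrakk> \<Longrightarrow> bracket H a b c \<in> carrier H"
    and assoc:
      "\<lbrakk>a \<in> carrier H; b \<in> carrier H; c \<in> carrier H; d \<in> carrier H; e \<in> carrier H\<rbrakk> \<Longrightarrow>
        bracket H (bracket H a b c) d e = bracket H a b (bracket H c d e)"
    and cancel_right [simp]:
      "\<lbrakk>a \<in> carrier H; b \<in> carrier H\<rbrakk> \<Longrightarrow> bracket H a b b = a"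
    and cancel_left [simp]:
      "\<lbrakk>a \<in> carrier H; b \<in> carrier H\<rbrakk> \<Longrightarrow> bracket H b b a = a"

locale abelian_heap = heap +
  assumes comm:
      "\<lbrakk>a \<in> carrier H; b \<in> carrier H; c \<in> carrier H\<rbrakk> \<Longrightarrow> bracket H a b c = bracket H c b a"

definition heap_hom :: "('a, 'm) heap_scheme \<Rightarrow> ('b, 'n) heap_scheme \<Rightarrow> ('a \<Rightarrow> 'b) set"
  where "heap_hom H K =
    {f \<in> carrier H \<rightarrow> carrier K. \<forall>a\<in>carrier H. \<forall>b\<in>carrier H. \<forall>c\<in>carrier H.
       f (bracket H a b c) = bracket K (f a) (f b) (f c)}"

definition heap_iso :: "('a, 'm) heap_scheme \<Rightarrow> ('b, 'n) heap_scheme \<Rightarrow> ('a \<Rightarrow> 'b) set"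
  where "heap_iso H K = {f \<in> heap_hom H K. bij_betw f (carrier H) (carrier K)}"

definition is_heap_iso :: "('a, 'm) heap_scheme \<Rightarrow> ('b, 'n) heap_scheme \<Rightarrow> bool"
    (infix \<open>\<cong>\<^sub>h\<close> 50)
  where "H \<cong>\<^sub>h K \<longleftrightarrow> heap_iso H K \<noteq> {}"


section \<open>Heaps and groups\<close>

definition heap_retract :: "('a, 'm) heap_scheme \<Rightarrow> 'a \<Rightarrow> 'a monoid"
  where "heap_retract H e = \<lparr>carrier = carrier H, monoid.mult = (\<lambda>a b. bracket H a e b), one = e\<rparr>"

definition group_heap :: "('a, 'm) monoid_scheme \<Rightarrow> 'a heap"
  where "group_heap G =
    \<lparr>carrier = carrier G, bracket = (\<lambda>g h k. g \<otimes>\<^bsub>G\<^esub> inv\<^bsub>G\<^esub> h \<otimes>\<^bsub>G\<^esub> k)\<rparr>"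

lemma heap_retract_group:
  assumes "heap H" "e \<in> carrier H"
  shows "group (heap_retract H e)"
proof -
  interpret heap H by fact
  show ?thesis
  proof (rule groupI)
    fix x assume x: "x \<in> carrier (heap_retract H e)"
    then have "bracket H (bracket H e x e) e x = e"
      using assms(2) by (simp add: heap_retract_def assoc)
    then show "\<exists>y\<in>carrier (heap_retract H e). y \<otimes>\<^bsub>heap_retract H e\<^esub> x = \<one>\<^bsub>heap_retract H e\<^esub>"
      using x assms(2) by (auto simp: heap_retract_def intro!: bexI[of _ "bracket H e x e"])
  qed (use assms(2) in \<open>auto simp: heap_retract_def assoc\<close>)
qed

lemma heap_retract_comm_group:
  assumes "abelian_heap H" "e \<in> carrier H"
  shows "comm_group (heap_retract H e)"
proof -
  interpret abelian_heap H by fact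
  interpret G: group "heap_retract H e"
    using heap_retract_group[OF heap_axioms assms(2)] .
  show ?thesis
    by (rule G.group_comm_groupI) (use assms(2) in \<open>simp add: heap_retract_def comm\<close>)
qed

lemma group_heap_heap:
  assumes "group G"
  shows "heap (group_heap G)"
proof -
  interpret group G by fact
  show ?thesis
    by unfold_locales (auto simp: group_heap_def m_assoc)
qed

lemma group_heap_abelian_heap:
  assumes "comm_group G"
  shows "abelian_heap (group_heap G)"
proof -
  interpret comm_group G by fact
  interpret heap "group_heap G"
    by (rule group_heap_heap) (rule is_group)
  show ?thesis
    by unfold_locales (auto simp: group_heap_def m_ac)
qed


section \<open>Coproducts of Abelian heaps\<close>

text \<open>
  The universal property of a coproduct, with test objects the Abelian heaps on subsets of the
  type \<open>'t\<close>.  Being a coproduct in the category of Abelian heaps means that this holds for every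
  type \<open>'t\<close>, which a single formula cannot express.  The direct sum is therefore
  constructed below, and its universal property is proved with \<open>'t\<close> arbitrary.
\<close>

definition is_coproduct ::
  "'t itself \<Rightarrow> ('a, 'k) heap_scheme \<Rightarrow> ('b, 'm) heap_scheme \<Rightarrow> ('c, 'n) heap_scheme
    \<Rightarrow> ('a \<Rightarrow> 'c) \<Rightarrow> ('b \<Rightarrow> 'c) \<Rightarrow> bool"
  where "is_coproduct _ A B C i j \<longleftrightarrow>
    abelian_heap C \<and> i \<in> heap_hom A C \<and> j \<in> heap_hom B C \<and>
    (\<forall>(T :: 't heap) f g. abelian_heap T \<and> f \<in> heap_hom A T \<and> g \<in> heap_hom B T \<longrightarrow>
      (\<exists>h\<in>heap_hom C T.
        (\<forall>a\<in>carrier A. h (i a) = f a) \<and> (\<forall>b\<in>carrier B. h (j b) = g b) \<and>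
        (\<forall>h'\<in>heap_hom C T.
          (\<forall>a\<in>carrier A. h' (i a) = f a) \<and> (\<forall>b\<in>carrier B. h' (j b) = g b) \<longrightarrow>
          (\<forall>x\<in>carrier C. h' x = h x))))"

text \<open>
  The direct sum is the Abelian heap generated by the disjoint union of \<open>A\<close> and \<open>B\<close>, subject
  to the relations that make the inclusions of \<open>A\<close> and \<open>B\<close> heap morphisms: formal bracket
  expressions in elements of \<open>A\<close> and \<open>B\<close>, modulo the congruence generated by the axioms of an
  Abelian heap and by these relations.
\<close>

datatype 'x heap_term = Gen 'x | Br "'x heap_term" "'x heap_term" "'x heap_term"

inductive_set heap_terms :: "'x set \<Rightarrow> 'x heap_term set" for U :: "'x set"
  where
    Gen: "x \<in> U \<Longrightarrow> Gen x \<in> heap_terms U"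
  | Br: "\<lbrakk>s \<in> heap_terms U; t \<in> heap_terms U; u \<in> heap_terms U\<rbrakk> \<Longrightarrow> Br s t u \<in> heap_terms U"

abbreviation sum_terms ::
  "('a, 'm) heap_scheme \<Rightarrow> ('b, 'n) heap_scheme \<Rightarrow> ('a + 'b) heap_term set"
  where "sum_terms A B \<equiv> heap_terms (Sum_Type.Plus (carrier A) (carrier B))"

inductive_set sum_rel ::
  "('a, 'm) heap_scheme \<Rightarrow> ('b, 'n) heap_scheme \<Rightarrow> (('a + 'b) heap_term \<times> ('a + 'b) heap_term) set"
  for A :: "('a, 'm) heap_scheme" and B :: "('b, 'n) heap_scheme"
  where
    refl: "t \<in> sum_terms A B \<Longrightarrow> (t, t) \<in> sum_rel A B"
  | sym: "(s, t) \<in> sum_rel A B \<Longrightarrow> (t, s) \<in> sum_rel A B"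
  | trans: "\<lbrakk>(s, t) \<in> sum_rel A B; (t, u) \<in> sum_rel A B\<rbrakk> \<Longrightarrow> (s, u) \<in> sum_rel A B"
  | cong: "\<lbrakk>(s, s') \<in> sum_rel A B; (t, t') \<in> sum_rel A B; (u, u') \<in> sum_rel A B\<rbrakk> \<Longrightarrow>
      (Br s t u, Br s' t' u') \<in> sum_rel A B"
  | assoc: "\<lbrakk>p \<in> sum_terms A B; q \<in> sum_terms A B; r \<in> sum_terms A B;
      s \<in> sum_terms A B; t \<in> sum_terms A B\<rbrakk> \<Longrightarrow>
      (Br (Br p q r) s t, Br p q (Br r s t)) \<in> sum_rel A B"
  | cancel_right: "\<lbrakk>s \<in> sum_terms A B; t \<in> sum_terms A B\<rbrakk> \<Longrightarrow> (Br s t t, s) \<in> sum_rel A B"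
  | cancel_left: "\<lbrakk>s \<in> sum_terms A B; t \<in> sum_terms A B\<rbrakk> \<Longrightarrow> (Br t t s, s) \<in> sum_rel A B"
  | comm: "\<lbrakk>s \<in> sum_terms A B; t \<in> sum_terms A B; u \<in> sum_terms A B\<rbrakk> \<Longrightarrow>
      (Br s t u, Br u t s) \<in> sum_rel A B"
  | left: "\<lbrakk>a \<in> carrier A; b \<in> carrier A; c \<in> carrier A\<rbrakk> \<Longrightarrow>
      (Gen (Inl (bracket A a b c)), Br (Gen (Inl a)) (Gen (Inl b)) (Gen (Inl c))) \<in> sum_rel A B"
  | right: "\<lbrakk>a \<in> carrier B; b \<in> carrier B; c \<in> carrier B\<rbrakk> \<Longrightarrow>
      (Gen (Inr (bracket B a b c)), Br (Gen (Inr a)) (Gen (Inr b)) (Gen (Inr c))) \<in> sum_rel A B"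

definition heap_sum ::
  "('a, 'm) heap_scheme \<Rightarrow> ('b, 'n) heap_scheme \<Rightarrow> ('a + 'b) heap_term set heap"
    (infixr \<open>\<boxplus>\<close> 65)
  where "A \<boxplus> B =
    \<lparr>carrier = sum_terms A B // sum_rel A B,
     bracket = (\<lambda>U V W. \<Union>s\<in>U. \<Union>t\<in>V. \<Union>u\<in>W. sum_rel A B `` {Br s t u})\<rparr>"

definition sum_inl ::
  "('a, 'm) heap_scheme \<Rightarrow> ('b, 'n) heap_scheme \<Rightarrow> 'a \<Rightarrow> ('a + 'b) heap_term set"
  where "sum_inl A B a = sum_rel A B `` {Gen (Inl a)}"

definition sum_inr ::
  "('a, 'm) heap_scheme \<Rightarrow> ('b, 'n) heap_scheme \<Rightarrow> 'b \<Rightarrow> ('a + 'b) heap_term set"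
  where "sum_inr A B b = sum_rel A B `` {Gen (Inr b)}"

lemma sum_rel_terms:
  assumes "heap A" "heap B" "(s, t) \<in> sum_rel A B"
  shows "s \<in> sum_terms A B \<and> t \<in> sum_terms A B"
  using assms(3)
  by induction (auto intro!: heap_terms.intros heap.closed[OF assms(1)] heap.closed[OF assms(2)])

lemma equiv_sum_rel:
  assumes "heap A" "heap B"
  shows "equiv (sum_terms A B) (sum_rel A B)"
proof (rule equivI)
  show "sum_rel A B \<subseteq> sum_terms A B \<times> sum_terms A B"
    using sum_rel_terms[OF assms] by auto
  show "refl_on (sum_terms A B) (sum_rel A B)"
    by (auto simp: refl_on_def intro: sum_rel.refl)
  show "Relation.sym (sum_rel A B)"
    by (auto simp: Relation.sym_def intro: sum_rel.sym)
  show "Relation.trans (sum_rel A B)"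
    unfolding Relation.trans_def by (blast intro: sum_rel.trans)
qed

lemma bracket_heap_sum:
  assumes "heap A" "heap B" "s \<in> sum_terms A B" "t \<in> sum_terms A B" "u \<in> sum_terms A B"
  shows "bracket (A \<boxplus> B) (sum_rel A B `` {s}) (sum_rel A B `` {t}) (sum_rel A B `` {u}) =
    sum_rel A B `` {Br s t u}"
proof -
  note E = equiv_sum_rel[OF assms(1,2)]
  have *: "sum_rel A B `` {Br s' t' u'} = sum_rel A B `` {Br s t u}"
    if "(s, s') \<in> sum_rel A B" "(t, t') \<in> sum_rel A B" "(u, u') \<in> sum_rel A B" for s' t' u'
    using equiv_class_eq[OF E sum_rel.cong[OF that]] by simp
  have refl: "s \<in> sum_rel A B `` {s}" "t \<in> sum_rel A B `` {t}" "u \<in> sum_rel A B `` {u}"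
    using assms by (auto intro: sum_rel.refl)
  have "(\<Union>s'\<in>sum_rel A B `` {s}. \<Union>t'\<in>sum_rel A B `` {t}. \<Union>u'\<in>sum_rel A B `` {u}.
      sum_rel A B `` {Br s' t' u'}) = sum_rel A B `` {Br s t u}" (is "?L = ?R")
  proof
    show "?L \<subseteq> ?R"
    proof (intro UN_least)
      fix s' t' u'
      assume "s' \<in> sum_rel A B `` {s}" "t' \<in> sum_rel A B `` {t}" "u' \<in> sum_rel A B `` {u}"
      then show "sum_rel A B `` {Br s' t' u'} \<subseteq> sum_rel A B `` {Br s t u}"
        using *[of s' t' u'] by (simp only: Image_singleton_iff subset_refl)
    qed
    show "?R \<subseteq> ?L"
    proof
      fix x
      assume "x \<in> ?R"
      with refl show "x \<in> ?L"
        unfolding UN_iff by (intro bexI)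
    qed
  qed
  then show ?thesis
    by (simp only: heap_sum_def heap.select_convs)
qed

lemma carrier_heap_sumE:
  assumes "U \<in> carrier (A \<boxplus> B)"
  obtains s where "s \<in> sum_terms A B" "U = sum_rel A B `` {s}"
  using assms by (auto simp: heap_sum_def quotient_def)

lemma class_in_heap_sum: "s \<in> sum_terms A B \<Longrightarrow> sum_rel A B `` {s} \<in> carrier (A \<boxplus> B)"
  by (auto simp: heap_sum_def quotient_def)

lemma abelian_heap_sum:
  assumes A: "heap A" and B: "heap B"
  shows "abelian_heap (A \<boxplus> B)"
proof -
  note E = equiv_class_eq[OF equiv_sum_rel[OF A B]]
  note cl = class_in_heap_sum[of _ A B]
  note S = bracket_heap_sum[OF A B] heap_terms.Br
  show ?thesis
  proof
    fix a b assume "a \<in> carrier (A \<boxplus> B)" "b \<in> carrier (A \<boxplus> B)"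
    then obtain s t where *: "s \<in> sum_terms A B" "t \<in> sum_terms A B"
      "a = sum_rel A B `` {s}" "b = sum_rel A B `` {t}"
      by (meson carrier_heap_sumE)
    show "bracket (A \<boxplus> B) a b b = a"
      unfolding *(3,4) S(1)[OF *(1,2,2)] by (intro E sum_rel.cancel_right *(1,2))
    show "bracket (A \<boxplus> B) b b a = a"
      unfolding *(3,4) S(1)[OF *(2,2,1)] by (intro E sum_rel.cancel_left *(1,2))
  next
    fix a b c
    assume "a \<in> carrier (A \<boxplus> B)" "b \<in> carrier (A \<boxplus> B)" "c \<in> carrier (A \<boxplus> B)"
    then obtain s t u where *: "s \<in> sum_terms A B" "t \<in> sum_terms A B" "u \<in> sum_terms A B"
      "a = sum_rel A B `` {s}" "b = sum_rel A B `` {t}" "c = sum_rel A B `` {u}"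
      by (meson carrier_heap_sumE)
    show "bracket (A \<boxplus> B) a b c \<in> carrier (A \<boxplus> B)"
      unfolding *(4-6) S(1)[OF *(1-3)] by (intro cl heap_terms.Br *(1-3))
    show "bracket (A \<boxplus> B) a b c = bracket (A \<boxplus> B) c b a"
      unfolding *(4-6) S(1)[OF *(1-3)] S(1)[OF *(3,2,1)] by (intro E sum_rel.comm *(1-3))
  next
    fix a b c d e
    assume "a \<in> carrier (A \<boxplus> B)" "b \<in> carrier (A \<boxplus> B)" "c \<in> carrier (A \<boxplus> B)"
      "d \<in> carrier (A \<boxplus> B)" "e \<in> carrier (A \<boxplus> B)"
    then obtain p q r s t where *: "p \<in> sum_terms A B" "q \<in> sum_terms A B" "r \<in> sum_terms A B"
      "s \<in> sum_terms A B" "t \<in> sum_terms A B"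
      "a = sum_rel A B `` {p}" "b = sum_rel A B `` {q}" "c = sum_rel A B `` {r}"
      "d = sum_rel A B `` {s}" "e = sum_rel A B `` {t}"
      by (meson carrier_heap_sumE)
    have "sum_rel A B `` {Br (Br p q r) s t} = sum_rel A B `` {Br p q (Br r s t)}"
      by (intro E sum_rel.assoc *(1-5))
    with *(1-5) show "bracket (A \<boxplus> B) (bracket (A \<boxplus> B) a b c) d e =
        bracket (A \<boxplus> B) a b (bracket (A \<boxplus> B) c d e)"
      unfolding *(6-10) by (simp add: S)
  qed
qed

primrec eval_term :: "('t, 'm) heap_scheme \<Rightarrow> ('x \<Rightarrow> 't) \<Rightarrow> 'x heap_term \<Rightarrow> 't"
  where
    "eval_term T f (Gen x) = f x"
  | "eval_term T f (Br s t u) = bracket T (eval_term T f s) (eval_term T f t) (eval_term T f u)"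

theorem is_coproduct_heap_sum:
  assumes A: "heap A" and B: "heap B"
  shows "is_coproduct TYPE('t) A B (A \<boxplus> B) (sum_inl A B) (sum_inr A B)"
proof -
  note E = equiv_class_eq[OF equiv_sum_rel[OF A B]]
  have gen: "Gen (Inl a) \<in> sum_terms A B" if "a \<in> carrier A" for a
    using that by (auto intro: heap_terms.Gen)
  have gen': "Gen (Inr b) \<in> sum_terms A B" if "b \<in> carrier B" for b
    using that by (auto intro: heap_terms.Gen)
  have inl: "sum_inl A B \<in> heap_hom A (A \<boxplus> B)"
    unfolding heap_hom_def sum_inl_def
    by (auto simp: bracket_heap_sum[OF A B] gen intro!: class_in_heap_sum E sum_rel.left)
  have inr: "sum_inr A B \<in> heap_hom B (A \<boxplus> B)"
    unfolding heap_hom_def sum_inr_def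
    by (auto simp: bracket_heap_sum[OF A B] gen' intro!: class_in_heap_sum E sum_rel.right)
  have ex: "\<exists>h\<in>heap_hom (A \<boxplus> B) T.
        (\<forall>a\<in>carrier A. h (sum_inl A B a) = f a) \<and> (\<forall>b\<in>carrier B. h (sum_inr A B b) = g b) \<and>
        (\<forall>h'\<in>heap_hom (A \<boxplus> B) T.
          (\<forall>a\<in>carrier A. h' (sum_inl A B a) = f a) \<and> (\<forall>b\<in>carrier B. h' (sum_inr A B b) = g b) \<longrightarrow>
          (\<forall>x\<in>carrier (A \<boxplus> B). h' x = h x))"
    if T: "abelian_heap T" and f: "f \<in> heap_hom A T" and g: "g \<in> heap_hom B T"
    for T :: "'t heap" and f g
  proof -
    interpret T: abelian_heap T by fact
    let ?e = "eval_term T (case_sum f g)"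
    define h where "h U = ?e (SOME s. s \<in> U)" for U
    have cl: "?e s \<in> carrier T" if "s \<in> sum_terms A B" for s
      using that f g by induction (auto simp: heap_hom_def)
    have rel: "?e s = ?e t" if "(s, t) \<in> sum_rel A B" for s t
      using that
    proof induction
      case (comm s t u)
      then show ?case by (simp add: cl T.comm[of "?e s"])
    qed (use f g in \<open>auto simp: cl T.assoc heap_hom_def\<close>)
    have h: "h (sum_rel A B `` {s}) = ?e s" if "s \<in> sum_terms A B" for s
    proof -
      have "s \<in> sum_rel A B `` {s}"
        using that by (auto intro: sum_rel.refl)
      then have "(SOME t. t \<in> sum_rel A B `` {s}) \<in> sum_rel A B `` {s}"
        by (rule someI)
      then show ?thesis
        unfolding h_def using rel by (metis Image_singleton_iff)
    qed
    have hom: "h \<in> heap_hom (A \<boxplus> B) T"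
      by (auto simp: heap_hom_def h cl bracket_heap_sum[OF A B] heap_terms.Br elim!: carrier_heap_sumE)
    have uniq: "h' U = h U"
      if h': "h' \<in> heap_hom (A \<boxplus> B) T"
        and l: "\<forall>a\<in>carrier A. h' (sum_inl A B a) = f a"
        and r: "\<forall>b\<in>carrier B. h' (sum_inr A B b) = g b"
        and U: "U \<in> carrier (A \<boxplus> B)" for h' U
    proof -
      have "h' (sum_rel A B `` {s}) = ?e s" if "s \<in> sum_terms A B" for s
        using that
      proof induction
        case (Gen x)
        then show ?case using l r by (auto simp: sum_inl_def sum_inr_def)
      next
        case (Br s t u)
        then have "h' (bracket (A \<boxplus> B) (sum_rel A B `` {s}) (sum_rel A B `` {t}) (sum_rel A B `` {u})) =
            bracket T (?e s) (?e t) (?e u)"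
          using h' by (simp add: heap_hom_def class_in_heap_sum)
        then show ?case using Br by (simp add: bracket_heap_sum[OF A B])
      qed
      then show ?thesis using U by (auto elim!: carrier_heap_sumE simp: h)
    qed
    show ?thesis
    proof (rule bexI[OF _ hom], intro conjI ballI impI)
      show "h (sum_inl A B a) = f a" if "a \<in> carrier A" for a
        using that by (simp add: sum_inl_def h gen)
      show "h (sum_inr A B b) = g b" if "b \<in> carrier B" for b
        using that by (simp add: sum_inr_def h gen')
    qed (elim conjE, rule uniq)
  qed
  show ?thesis
    unfolding is_coproduct_def
    by (intro conjI allI impI abelian_heap_sum[OF A B] inl inr) (elim conjE, rule ex)
qed

lemma heap_hom_comp:
  "\<lbrakk>f \<in> heap_hom H K; g \<in> heap_hom K L\<rbrakk> \<Longrightarrow> (\<lambda>x. g (f x)) \<in> heap_hom H L"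
  by (auto simp: heap_hom_def Pi_iff)

lemma is_coproductD:
  assumes "is_coproduct TYPE('t) A B C i j"
  shows "abelian_heap C" "i \<in> heap_hom A C" "j \<in> heap_hom B C"
  using assms unfolding is_coproduct_def by simp_all

lemma is_coproductE:
  fixes T :: "'t heap"
  assumes "is_coproduct TYPE('t) A B C i j" "abelian_heap T" "f \<in> heap_hom A T" "g \<in> heap_hom B T"
  obtains h where "h \<in> heap_hom C T"
    "\<forall>a\<in>carrier A. h (i a) = f a" "\<forall>b\<in>carrier B. h (j b) = g b"
    "\<forall>h'\<in>heap_hom C T.
      (\<forall>a\<in>carrier A. h' (i a) = f a) \<and> (\<forall>b\<in>carrier B. h' (j b) = g b) \<longrightarrow>
      (\<forall>x\<in>carrier C. h' x = h x)"
proof -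
  have "\<exists>h\<in>heap_hom C T.
        (\<forall>a\<in>carrier A. h (i a) = f a) \<and> (\<forall>b\<in>carrier B. h (j b) = g b) \<and>
        (\<forall>h'\<in>heap_hom C T.
          (\<forall>a\<in>carrier A. h' (i a) = f a) \<and> (\<forall>b\<in>carrier B. h' (j b) = g b) \<longrightarrow>
          (\<forall>x\<in>carrier C. h' x = h x))"
    by (rule assms(1)[unfolded is_coproduct_def, THEN conjunct2, THEN conjunct2, THEN conjunct2,
      THEN spec[of _ T], THEN spec[of _ f], THEN spec[of _ g], THEN mp]) (intro conjI assms(2-4))
  then show thesis
    by (elim bexE conjE) (rule that)
qed

lemma coproduct_endo:
  fixes C :: "'c heap"
  assumes "is_coproduct TYPE('c) A B C i j" "h \<in> heap_hom C C"
    "\<forall>a\<in>carrier A. h (i a) = i a" "\<forall>b\<in>carrier B. h (j b) = j b"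
    "x \<in> carrier C"
  shows "h x = x"
proof -
  obtain k where "k \<in> heap_hom C C"
    "\<forall>a\<in>carrier A. k (i a) = i a" "\<forall>b\<in>carrier B. k (j b) = j b"
    and k: "\<forall>h'\<in>heap_hom C C.
      (\<forall>a\<in>carrier A. h' (i a) = i a) \<and> (\<forall>b\<in>carrier B. h' (j b) = j b) \<longrightarrow>
      (\<forall>x\<in>carrier C. h' x = k x)"
    by (rule is_coproductE[OF assms(1) is_coproductD[OF assms(1)]])
  have "(\<lambda>x. x) \<in> heap_hom C C"
    by (auto simp: heap_hom_def)
  from k[THEN bspec, OF this] have "x = k x"
    using assms(5) by simp
  moreover from k[THEN bspec, OF assms(2)] have "h x = k x"
    using assms(3-5) by simp
  ultimately show ?thesis by simp
qed

text \<open>Coproducts are unique up to isomorphism, so \<open>A \<boxplus> B\<close> stands for any of them.\<close>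

theorem is_coproduct_unique:
  fixes C :: "'c heap" and D :: "'d heap"
  assumes C: "is_coproduct TYPE('c) A B C i j" "is_coproduct TYPE('d) A B C i j"
    and D: "is_coproduct TYPE('c) A B D k l" "is_coproduct TYPE('d) A B D k l"
  shows "C \<cong>\<^sub>h D"
proof -
  obtain h where h: "h \<in> heap_hom C D"
    "\<forall>a\<in>carrier A. h (i a) = k a" "\<forall>b\<in>carrier B. h (j b) = l b"
    by (rule is_coproductE[OF C(2) is_coproductD[OF D(1)]]) (rule that)
  obtain h' where h': "h' \<in> heap_hom D C"
    "\<forall>a\<in>carrier A. h' (k a) = i a" "\<forall>b\<in>carrier B. h' (l b) = j b"
    by (rule is_coproductE[OF D(1) is_coproductD[OF C(1)]]) (rule that)
  have "h' (h x) = x" if "x \<in> carrier C" for x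
    by (rule coproduct_endo[OF C(1) heap_hom_comp[OF h(1) h'(1)]]) (use that in \<open>simp_all add: h h'\<close>)
  moreover have "h (h' x) = x" if "x \<in> carrier D" for x
    by (rule coproduct_endo[OF D(2) heap_hom_comp[OF h'(1) h(1)]]) (use that in \<open>simp_all add: h h'\<close>)
  ultimately have "bij_betw h (carrier C) (carrier D)"
    using h(1) h'(1) by (intro bij_betwI[where g = h']) (auto simp: heap_hom_def)
  then show ?thesis
    using h(1) by (auto simp: is_heap_iso_def heap_iso_def)
qed

end

theory Submission
  imports Defs
begin

text \<open>
  Write \<open>P\<close> for the heap of \<open>G(A; eA) \<oplus> G(B; eB) \<oplus> \<int>\<close>.  Coproducts are unique up to isomorphism,
  so it suffices that \<open>P\<close>, with the injections \<open>a \<mapsto> (a, eB, 0)\<close> and \<open>b \<mapsto> (eA, b, 1)\<close>, has the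
  universal property of \<open>A \<boxplus> B\<close>.  The summand \<open>\<int>\<close> records the displacement between the two
  base points, which a heap morphism out of \<open>A \<boxplus> B\<close> may choose freely.

  Let \<open>f\<close> and \<open>g\<close> be heap morphisms from \<open>A\<close> and \<open>B\<close> to an Abelian heap \<open>T\<close>.  Since \<open>A\<close> is
  nonempty, so is \<open>T\<close>, and it is the heap of the Abelian group \<open>K = G(T; f eA)\<close>.  A heap morphism
  from \<open>P\<close> to \<open>T\<close> extending \<open>f\<close> sends the neutral element to \<open>f eA\<close>, so it is a group homomorphism
  to \<open>K\<close>, which is written additively below.  Here \<open>f\<close> is a homomorphism from
  \<open>G(A; eA)\<close> to \<open>K\<close>, and \<open>b \<mapsto> g b - g eB\<close> is one from \<open>G(B; eB)\<close>.  Hence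
  \<open>(a, b, n) \<mapsto> f a + (g b - g eB) + n \<cdot> g eB\<close> is a homomorphism
  extending \<open>f\<close> and \<open>g\<close>, and it is the only one because the elements \<open>(a, eB, 0)\<close> and
  \<open>(eA, b, 1)\<close> generate the group.
\<close>

section \<open>Heap morphisms and group homomorphisms\<close>

lemma heap_retract_simps [simp]:
  "carrier (heap_retract H e) = carrier H"
  "x \<otimes>\<^bsub>heap_retract H e\<^esub> y = bracket H x e y"
  "\<one>\<^bsub>heap_retract H e\<^esub> = e"
  by (simp_all add: heap_retract_def)

lemma group_heap_simps [simp]:
  "carrier (group_heap G) = carrier G"
  "bracket (group_heap G) x y z = x \<otimes>\<^bsub>G\<^esub> inv\<^bsub>G\<^esub> y \<otimes>\<^bsub>G\<^esub> z"
  by (simp_all add: group_heap_def)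

lemma inv_heap_retract:
  assumes "heap H" "e \<in> carrier H" "x \<in> carrier H"
  shows "inv\<^bsub>heap_retract H e\<^esub> x = bracket H e x e"
proof -
  interpret heap H by fact
  interpret G: group "heap_retract H e"
    using heap_retract_group[OF assms(1,2)] .
  show ?thesis
    using assms(2,3) by (intro G.inv_equality) (auto simp: assoc)
qed

lemma bracket_group_heap_retract:
  assumes "heap H" "e \<in> carrier H" "x \<in> carrier H" "y \<in> carrier H" "z \<in> carrier H"
  shows "bracket (group_heap (heap_retract H e)) x y z = bracket H x y z"
proof -
  interpret heap H by fact
  have "bracket H (bracket H x e (bracket H e y e)) e z
      = bracket H (bracket H (bracket H x e e) y e) e z"
    using assms by (simp only: assoc closed)
  also have "\<dots> = bracket H x y z"
    using assms by (simp add: assoc)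
  finally show ?thesis
    using assms by (simp add: inv_heap_retract)
qed

lemma heap_hom_group_heap_retract:
  assumes "heap T" "e \<in> carrier T"
  shows "heap_hom H (group_heap (heap_retract T e)) = heap_hom H T"
  unfolding heap_hom_def
  by (intro Collect_cong conj_cong ball_cong refl)
    (auto simp del: group_heap_simps(2) simp: bracket_group_heap_retract[OF assms] Pi_iff)

lemma hom_imp_heap_hom:
  assumes "group G" "group K" "h \<in> hom G K"
  shows "h \<in> heap_hom (group_heap G) (group_heap K)"
proof -
  interpret group_hom G K h
    using assms by (simp add: group_hom_def group_hom_axioms_def)
  show ?thesis
    by (auto simp: heap_hom_def)
qed

lemma heap_hom_imp_hom:
  assumes "group G" "group K"
    and h: "h \<in> heap_hom (group_heap G) (group_heap K)" "h \<one>\<^bsub>G\<^esub> = \<one>\<^bsub>K\<^esub>"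
  shows "h \<in> hom G K"
proof (rule homI)
  interpret G: group G by fact
  interpret K: group K by fact
  show cl: "h x \<in> carrier K" if "x \<in> carrier G" for x
    using h that by (auto simp: heap_hom_def)
  fix x y assume xy: "x \<in> carrier G" "y \<in> carrier G"
  then have "h (x \<otimes>\<^bsub>G\<^esub> inv\<^bsub>G\<^esub> \<one>\<^bsub>G\<^esub> \<otimes>\<^bsub>G\<^esub> y) = h x \<otimes>\<^bsub>K\<^esub> inv\<^bsub>K\<^esub> h \<one>\<^bsub>G\<^esub> \<otimes>\<^bsub>K\<^esub> h y"
    using h(1) unfolding heap_hom_def by (simp del: G.inv_one)
  then show "h (x \<otimes>\<^bsub>G\<^esub> y) = h x \<otimes>\<^bsub>K\<^esub> h y"
    using xy h(2) by (simp add: cl)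
qed

text \<open>A heap morphism to a group becomes a homomorphism once its value at the base point is
  divided out.\<close>

lemma heap_hom_retract_imp_hom:
  assumes "heap H" "e \<in> carrier H" "group K" "g \<in> heap_hom H (group_heap K)"
  shows "(\<lambda>x. g x \<otimes>\<^bsub>K\<^esub> inv\<^bsub>K\<^esub> g e) \<in> hom (heap_retract H e) K"
proof (rule homI)
  interpret K: group K by fact
  have cl: "g x \<in> carrier K" if "x \<in> carrier H" for x
    using assms(4) that by (auto simp: heap_hom_def)
  show "g x \<otimes>\<^bsub>K\<^esub> inv\<^bsub>K\<^esub> g e \<in> carrier K" if "x \<in> carrier (heap_retract H e)" for x
    using that assms(2) by (simp add: cl)
  fix x y assume "x \<in> carrier (heap_retract H e)" "y \<in> carrier (heap_retract H e)"
  then show "g (x \<otimes>\<^bsub>heap_retract H e\<^esub> y) \<otimes>\<^bsub>K\<^esub> inv\<^bsub>K\<^esub> g e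
      = (g x \<otimes>\<^bsub>K\<^esub> inv\<^bsub>K\<^esub> g e) \<otimes>\<^bsub>K\<^esub> (g y \<otimes>\<^bsub>K\<^esub> inv\<^bsub>K\<^esub> g e)"
    using assms(2,4) by (simp add: heap_hom_def cl K.m_assoc)
qed

section \<open>Homomorphisms out of direct products\<close>

lemma comm_group_DirProd:
  assumes "comm_group G" "comm_group H"
  shows "comm_group (G \<times>\<times> H)"
proof -
  interpret G: comm_group G by fact
  interpret H: comm_group H by fact
  interpret group "G \<times>\<times> H"
    by (rule DirProd_group[OF G.is_group H.is_group])
  show ?thesis
    by (rule group_comm_groupI) (auto simp: G.m_comm H.m_comm)
qed

lemma hom_DirProd_mult:
  assumes "comm_group K" "p \<in> hom G K" "q \<in> hom H K"
  shows "(\<lambda>(x, y). p x \<otimes>\<^bsub>K\<^esub> q y) \<in> hom (G \<times>\<times> H) K"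
proof -
  interpret K: comm_group K by fact
  show ?thesis
    using assms(2,3) by (auto simp: hom_def Pi_iff K.m_ac)
qed

lemma hom_integer_group_eq_pow:
  assumes "group K" "h \<in> hom integer_group K"
  shows "h n = h 1 [^]\<^bsub>K\<^esub> n"
proof -
  have "h (1 [^]\<^bsub>integer_group\<^esub> n) = h 1 [^]\<^bsub>K\<^esub> n"
    using assms by (intro hom_int_pow) auto
  then show ?thesis
    by (simp)
qed

text \<open>The elements \<open>(x, 1, 0)\<close> and \<open>(1, y, 1)\<close> generate \<open>G \<times> H \<times> \<int>\<close>.\<close>

lemma hom_DirProd_integer_group_eqI:
  assumes "group G" "group H" "group K"
    and h: "h \<in> hom (G \<times>\<times> H \<times>\<times> integer_group) K"
    and k: "k \<in> hom (G \<times>\<times> H \<times>\<times> integer_group) K"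
    and l: "\<And>x. x \<in> carrier G \<Longrightarrow> h (x, \<one>\<^bsub>H\<^esub>, 0) = k (x, \<one>\<^bsub>H\<^esub>, 0)"
    and r: "\<And>y. y \<in> carrier H \<Longrightarrow> h (\<one>\<^bsub>G\<^esub>, y, 1) = k (\<one>\<^bsub>G\<^esub>, y, 1)"
    and xyn: "x \<in> carrier G" "y \<in> carrier H"
  shows "h (x, y, n) = k (x, y, n)"
proof -
  interpret G: group G by fact
  interpret H: group H by fact
  interpret K: group K by fact
  \<comment> \<open>In the group, \<open>(x, y, n)\<close> is the product of \<open>(x, 1, 0)\<close>, \<open>(1, y, 1)\<close> and the power
    \<open>n - 1\<close> of \<open>(1, 1, 1)\<close>; the last factor offsets the \<open>1\<close> in the second.\<close>
  have split: "m (x, y, n) =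
      m (x, \<one>\<^bsub>H\<^esub>, 0) \<otimes>\<^bsub>K\<^esub> (m (\<one>\<^bsub>G\<^esub>, y, 1) \<otimes>\<^bsub>K\<^esub> m (\<one>\<^bsub>G\<^esub>, \<one>\<^bsub>H\<^esub>, 1) [^]\<^bsub>K\<^esub> (n - 1))"
    if m: "m \<in> hom (G \<times>\<times> H \<times>\<times> integer_group) K" for m
  proof -
    have mult: "m (a \<otimes>\<^bsub>G\<^esub> a', b \<otimes>\<^bsub>H\<^esub> b', c + c') = m (a, b, c) \<otimes>\<^bsub>K\<^esub> m (a', b', c')"
      if "a \<in> carrier G" "a' \<in> carrier G" "b \<in> carrier H" "b' \<in> carrier H" for a a' b b' c c'
      using hom_mult[OF m, of "(a, b, c)" "(a', b', c')"] that by simp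
    have "(\<lambda>c. m (\<one>\<^bsub>G\<^esub>, \<one>\<^bsub>H\<^esub>, c)) \<in> hom integer_group K"
      using m mult[of "\<one>\<^bsub>G\<^esub>" "\<one>\<^bsub>G\<^esub>" "\<one>\<^bsub>H\<^esub>" "\<one>\<^bsub>H\<^esub>"] by (auto simp: hom_def)
    from hom_integer_group_eq_pow[OF \<open>group K\<close> this, of "n - 1"]
    have "m (\<one>\<^bsub>G\<^esub>, \<one>\<^bsub>H\<^esub>, 1) [^]\<^bsub>K\<^esub> (n - 1) = m (\<one>\<^bsub>G\<^esub>, \<one>\<^bsub>H\<^esub>, n - 1)"
      by simp
    then show ?thesis
      using mult[of "\<one>\<^bsub>G\<^esub>" "\<one>\<^bsub>G\<^esub>" y "\<one>\<^bsub>H\<^esub>" 1 "n - 1"] mult[of x "\<one>\<^bsub>G\<^esub>" "\<one>\<^bsub>H\<^esub>" y 0 n] xyn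
      by simp
  qed
  show ?thesis
    using split[OF h] split[OF k] l[OF xyn(1)] r[OF xyn(2)] r[OF H.one_closed] by simp
qed

section \<open>The coproduct of two pointed Abelian heaps\<close>

text \<open>The type \<open>'t\<close> of the test objects is arbitrary: uniqueness of coproducts needs the universal
  property of both heaps at each of their two carrier types.\<close>

lemma is_coproduct_retracts_integers:
  fixes A :: "('a, 'k) heap_scheme" and B :: "('b, 'm) heap_scheme"
  assumes A: "abelian_heap A" and B: "abelian_heap B"
    and eA: "eA \<in> carrier A" and eB: "eB \<in> carrier B"
  shows "is_coproduct TYPE('t) A B
    (group_heap (heap_retract A eA \<times>\<times> heap_retract B eB \<times>\<times> integer_group))
    (\<lambda>a. (a, eB, 0)) (\<lambda>b. (eA, b, 1))"
proof -
  interpret A: abelian_heap A by fact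
  interpret B: abelian_heap B by fact
  let ?GA = "heap_retract A eA" and ?GB = "heap_retract B eB"
  let ?P = "?GA \<times>\<times> ?GB \<times>\<times> integer_group"
  interpret GA: comm_group ?GA using heap_retract_comm_group[OF A eA] .
  interpret GB: comm_group ?GB using heap_retract_comm_group[OF B eB] .
  have P: "comm_group ?P"
    by (intro comm_group_DirProd GA.comm_group_axioms GB.comm_group_axioms abelian_integer_group)
  then have gP: "group ?P"
    by (simp add: comm_group_def)
  have inv: "inv\<^bsub>?P\<^esub> (a, b, n) = (inv\<^bsub>?GA\<^esub> a, inv\<^bsub>?GB\<^esub> b, - n)"
    if "a \<in> carrier A" "b \<in> carrier B" for a b n
    using that by (simp add: inv_DirProd DirProd_group GA.is_group GB.is_group)
  have brA: "bracket A (bracket A a eA (inv\<^bsub>?GA\<^esub> b)) eA c = bracket A a b c"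
    if "a \<in> carrier A" "b \<in> carrier A" "c \<in> carrier A" for a b c
    using bracket_group_heap_retract[OF A.heap_axioms eA that] by simp
  have brB: "bracket B (bracket B a eB (inv\<^bsub>?GB\<^esub> b)) eB c = bracket B a b c"
    if "a \<in> carrier B" "b \<in> carrier B" "c \<in> carrier B" for a b c
    using bracket_group_heap_retract[OF B.heap_axioms eB that] by simp
  have inl: "(\<lambda>a. (a, eB, 0)) \<in> heap_hom A (group_heap ?P)"
    using eA eB by (auto simp: heap_hom_def inv brA brB)
  have inr: "(\<lambda>b. (eA, b, 1)) \<in> heap_hom B (group_heap ?P)"
    using eA eB by (auto simp: heap_hom_def inv brA brB)
  have ex: "\<exists>h\<in>heap_hom (group_heap ?P) T.
        (\<forall>a\<in>carrier A. h (a, eB, 0) = f a) \<and> (\<forall>b\<in>carrier B. h (eA, b, 1) = g b) \<and>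
        (\<forall>h'\<in>heap_hom (group_heap ?P) T.
          (\<forall>a\<in>carrier A. h' (a, eB, 0) = f a) \<and> (\<forall>b\<in>carrier B. h' (eA, b, 1) = g b) \<longrightarrow>
          (\<forall>x\<in>carrier (group_heap ?P). h' x = h x))"
    if T: "abelian_heap T" and f: "f \<in> heap_hom A T" and g: "g \<in> heap_hom B T"
    for T :: "'t heap" and f g
  proof -
    interpret T: abelian_heap T by fact
    have o: "f eA \<in> carrier T"
      using f eA by (auto simp: heap_hom_def)
    define K where "K = heap_retract T (f eA)"
    interpret K: comm_group K
      unfolding K_def using heap_retract_comm_group[OF T o] .
    have carrier_K: "carrier K = carrier T" and one_K: "\<one>\<^bsub>K\<^esub> = f eA"
      by (simp_all add: K_def)
    have fcl: "f a \<in> carrier K" if "a \<in> carrier A" for a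
      using f that by (auto simp: heap_hom_def carrier_K)
    have gcl: "g b \<in> carrier K" if "b \<in> carrier B" for b
      using g that by (auto simp: heap_hom_def carrier_K)
    note hom_K = heap_hom_group_heap_retract[OF T.heap_axioms o, folded K_def]
    \<comment> \<open>Dividing by \<open>f eA\<close> changes nothing, because this is the neutral element of \<open>K\<close>.\<close>
    have "(\<lambda>x. f x \<otimes>\<^bsub>K\<^esub> inv\<^bsub>K\<^esub> f eA) \<in> hom ?GA K"
      using heap_hom_retract_imp_hom[OF A.heap_axioms eA K.is_group] f
      by (simp add: hom_K one_K)
    moreover have "f x \<otimes>\<^bsub>K\<^esub> inv\<^bsub>K\<^esub> f eA = f x" if "x \<in> carrier A" for x
      using fcl[OF that] by (simp flip: one_K)
    ultimately have p: "f \<in> hom ?GA K"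
      by (rule GA.hom_restrict) simp
    have q: "(\<lambda>b. g b \<otimes>\<^bsub>K\<^esub> inv\<^bsub>K\<^esub> g eB) \<in> hom ?GB K"
      using heap_hom_retract_imp_hom[OF B.heap_axioms eB K.is_group] g
      by (simp add: hom_K one_K)
    have z: "(\<lambda>n. g eB [^]\<^bsub>K\<^esub> n) \<in> hom integer_group K"
      by (intro K.hom_integer_group_pow gcl eB)
    define h where "h = (\<lambda>(a, c). f a \<otimes>\<^bsub>K\<^esub>
      (case c of (b, n) \<Rightarrow> (g b \<otimes>\<^bsub>K\<^esub> inv\<^bsub>K\<^esub> g eB) \<otimes>\<^bsub>K\<^esub> g eB [^]\<^bsub>K\<^esub> (n :: int)))"
    have h: "h \<in> hom ?P K"
      unfolding h_def by (intro hom_DirProd_mult K.comm_group_axioms p q z)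
    have hl: "h (a, eB, 0) = f a" if "a \<in> carrier A" for a
      using fcl[OF that] gcl[OF eB] by (simp add: h_def)
    have hr: "h (eA, b, 1) = g b" if "b \<in> carrier B" for b
      using gcl[OF that] gcl[OF eB]
      by (simp flip: one_K add: h_def K.m_assoc K.int_pow_1)
    have uniq: "h' x = h x"
      if h': "h' \<in> heap_hom (group_heap ?P) T"
        and l: "\<forall>a\<in>carrier A. h' (a, eB, 0) = f a"
        and r: "\<forall>b\<in>carrier B. h' (eA, b, 1) = g b"
        and x: "x \<in> carrier (group_heap ?P)" for h' x
    proof -
      have "h' \<in> hom ?P K"
        using heap_hom_imp_hom[OF gP K.is_group, of h'] h' l eA
        by (simp add: hom_K one_K)
      then show ?thesis
        using hom_DirProd_integer_group_eqI[OF GA.is_group GB.is_group K.is_group _ h, of h'] x l r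
        by (auto simp: hl hr)
    qed
    show ?thesis
    proof (rule bexI[of _ h], intro conjI ballI impI)
      show "h \<in> heap_hom (group_heap ?P) T"
        using hom_imp_heap_hom[OF gP K.is_group h]
        by (simp add: hom_K one_K)
    qed (auto intro: uniq simp: hl hr)
  qed
  show ?thesis
    unfolding is_coproduct_def
    by (intro conjI allI impI group_heap_abelian_heap P inl inr) (elim conjE, rule ex)
qed

theorem proposition3p9:
  fixes A :: "'a heap" and B :: "'b heap"
  assumes "abelian_heap A" and "abelian_heap B"
    and "eA \<in> carrier A" and "eB \<in> carrier B"
  shows "A \<boxplus> B \<cong>\<^sub>h group_heap (heap_retract A eA \<times>\<times> heap_retract B eB \<times>\<times> integer_group)"
proof -
  have "heap A" "heap B"
    using assms(1,2) by (simp_all add: abelian_heap_def)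
  then show ?thesis
    by (intro is_coproduct_unique[OF is_coproduct_heap_sum is_coproduct_heap_sum
          is_coproduct_retracts_integers is_coproduct_retracts_integers] assms)
qed

end
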